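(* Let $W\subset(\mathbb{R}_{\max}^n)^2$ be a closed polar cone. Assume that $s,t\in\mathbb{R}_{\max}^n$ are such that $(s,t)\notin W$. Then there exists $y\in\mathbb{R}_{\max}^n$ such that $$(f,g)\in W\implies \oplus_i f_iy_i\leq\oplus_j g_jy_j$$ and $$\oplus_i s_iy_i\not\leq\oplus_j t_jy_j.$$
   Context: $\mathbb{R}_{\max}$ is the max-plus semiring: the set $\mathbb{R}\cup\{-\infty\}$ with addition $a\oplus b=\max(a,b)$ and multiplication $ab=a\otimes b=a+b$ (with $-\infty$ absorbing), with the usual order; thus $\oplus_i f_iy_i=\max_i(f_i+y_i)$. Vectors are ordered entrywise. $\mathbb{R}_{\max}^n$ is a semimodule with entrywise $\oplus$ and scalar action $(x\lambda)_i=x_i+\lambda$; operations on $(\mathbb{R}_{\max}^n)^2$ are componentwise, and a subsemimodule is a subset stable under all combinations $x\lambda\oplus z\mu$ with $\lambda,\mu\in\mathbb{R}_{\max}$. A pre-congruence is a subsemimodule $W\subset(\mathbb{R}_{\max}^n)^2$ such that $(f,f)\in W$ for all $f\in\mathbb{R}_{\max}^n$, and $(f,g)\in W,\ (g,h)\in W\implies(f,h)\in W$. A polar cone is a pre-congruence $W$ such that $f\leq g\implies(f,g)\in W$. "Closed" refers to the product topology, where $\mathbb{R}_{\max}$ carries the metric $d(a,b)=|\exp(a)-\exp(b)|$ (with $\exp(-\infty)=0$). *)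

theory Defs
  imports "HOL-Analysis.Analysis"
begin

typedef rmax = "{x::ereal. x \<noteq> \<infinity>}"
  by (rule exI[of _ 0]) simp

setup_lifting type_definition_rmax

instantiation rmax :: linorder
begin
lift_definition less_eq_rmax :: "rmax \<Rightarrow> rmax \<Rightarrow> bool" is "(\<le>)" .
lift_definition less_rmax :: "rmax \<Rightarrow> rmax \<Rightarrow> bool" is "(<)" .
instance by standard (transfer; auto)+
end

(* Max-plus reading of the ring operations: + is the maximum (so a finite sum is a finite
   maximum), * is addition of numbers, 0 is minus infinity and 1 is the number 0.  The operations
   +, *s and \<le> on vectors are the componentwise ones induced by these. *)
instantiation rmax :: comm_semiring_1
begin
lift_definition zero_rmax :: rmax is "-\<infinity>" by simp
lift_definition one_rmax :: rmax is "0" by simp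
lift_definition plus_rmax :: "rmax \<Rightarrow> rmax \<Rightarrow> rmax" is max by (simp add: max_def)
lift_definition times_rmax :: "rmax \<Rightarrow> rmax \<Rightarrow> rmax" is "(+)" by simp
instance
proof
  fix a b c :: rmax
  show "a + b + c = a + (b + c)" by transfer (rule max.assoc)
  show "a + b = b + a" by transfer (rule max.commute)
  show "0 + a = a" by transfer (simp add: max_def)
  show "a * b * c = a * (b * c)" by transfer (rule add.assoc)
  show "a * b = b * a" by transfer (rule add.commute)
  show "1 * a = a" by transfer simp
  show "(a + b) * c = a * c + b * c"
    by transfer (metis add_right_mono linorder_le_cases max.absorb1 max.absorb2)
  show "0 * a = 0" by transfer simp
  show "a * 0 = 0" by transfer simp
  show "(0::rmax) \<noteq> 1" by transfer simp
qed
end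

lift_definition exp_rmax :: "rmax \<Rightarrow> real"
  is "\<lambda>x. if x = -\<infinity> then 0 else exp (real_of_ereal x)" .

lemma exp_rmax_inj: "exp_rmax a = exp_rmax b \<longleftrightarrow> a = b"
proof (transfer, goal_cases)
  case (1 a b)
  then show ?case by (cases a; cases b) auto
qed

instantiation rmax :: metric_space
begin
definition dist_rmax :: "rmax \<Rightarrow> rmax \<Rightarrow> real"
  where "dist_rmax a b = \<bar>exp_rmax a - exp_rmax b\<bar>"
definition uniformity_rmax :: "(rmax \<times> rmax) filter"
  where "uniformity_rmax = (INF e\<in>{0<..}. principal {(a, b). dist a b < e})"
definition open_rmax :: "rmax set \<Rightarrow> bool"
  where "open_rmax U \<longleftrightarrow> (\<forall>a\<in>U. \<forall>\<^sub>F (a', b) in uniformity. a' = a \<longrightarrow> b \<in> U)"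
instance
proof
  fix a b c :: rmax
  show "dist a b = 0 \<longleftrightarrow> a = b" by (simp add: dist_rmax_def exp_rmax_inj)
  show "dist a b \<le> dist a c + dist b c" by (simp add: dist_rmax_def)
qed (fact uniformity_rmax_def open_rmax_def)+
end

definition scale_pair :: "rmax \<Rightarrow> (rmax^'n) \<times> (rmax^'n) \<Rightarrow> (rmax^'n) \<times> (rmax^'n)"
  where "scale_pair c p = (c *s fst p, c *s snd p)"

definition subsemimodule :: "((rmax^'n) \<times> (rmax^'n)) set \<Rightarrow> bool"
  where "subsemimodule W \<longleftrightarrow>
    (\<forall>p\<in>W. \<forall>q\<in>W. \<forall>a b. scale_pair a p + scale_pair b q \<in> W)"

definition pre_congruence :: "((rmax^'n) \<times> (rmax^'n)) set \<Rightarrow> bool"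
  where "pre_congruence W \<longleftrightarrow> subsemimodule W \<and> (\<forall>f. (f, f) \<in> W) \<and>
    (\<forall>f g h. (f, g) \<in> W \<longrightarrow> (g, h) \<in> W \<longrightarrow> (f, h) \<in> W)"

definition polar_cone :: "((rmax^'n) \<times> (rmax^'n)) set \<Rightarrow> bool"
  where "polar_cone W \<longleftrightarrow> pre_congruence W \<and> (\<forall>f g. f \<le> g \<longrightarrow> (f, g) \<in> W)"

end

(* Write f \<preceq> g for (f, g) \<in> W.  As W is closed, t can be replaced by some t' that is strictly larger
   in every coordinate with still \<not> s \<preceq> t', and then \<not> s_k e_k \<preceq> t' for some k.  With u_i = s_k / t'_i,
   the functional y_i = inf {g . u | e_i \<preceq> g} separates: it respects \<preceq> because \<preceq> is transitive and
   stable under max-plus combinations; y_k \<ge> 1 because g . u \<le> 1 and e_k \<preceq> g would give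
   s_k e_k \<preceq> s_k g \<le> t'; and y \<le> u gives t . y < s_k \<le> s . y.  The passage to t' keeps u finite and
   makes the last inequality strict. *)

theory Submission imports Defs begin

section \<open>Order and arithmetic of the max-plus semifield\<close>

lemma rmax_add_eq_max: "a + b = max a (b::rmax)"
  by (simp only: max_def, transfer) (simp add: max_def)

lemma rmax_zero_le [simp]: "(0::rmax) \<le> a"
  by transfer simp

lemma rmax_pos_iff: "0 < a \<longleftrightarrow> a \<noteq> (0::rmax)"
  using rmax_zero_le[of a] by (auto simp: less_le)

text \<open>The inverse of a finite number is its negative, so every element but minus infinity can
  be divided by.\<close>

lemma rmax_inverse_exists:
  assumes "a \<noteq> (0::rmax)"
  obtains b where "a * b = 1"
proof -
  have "\<exists>b. a * b = 1"
    using assms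
  proof (transfer, goal_cases)
    case (1 a)
    then show ?case
      by (cases a) (auto intro!: exI[of _ "- a"] simp: zero_ereal_def)
  qed
  then show ?thesis using that by blast
qed

lemma rmax_mult_strict_left_mono:
  fixes a b c :: rmax
  assumes "a < b" "c \<noteq> 0"
  shows "c * a < c * b"
  using assms
proof (transfer, goal_cases)
  case (1 a b c)
  then show ?case by (cases a; cases b; cases c) auto
qed

lemma rmax_mult_less_cancel_left:
  fixes a b c :: rmax
  assumes "c \<noteq> 0"
  shows "c * a < c * b \<longleftrightarrow> a < b"
  by (metis assms rmax_mult_strict_left_mono linorder_neqE less_asym less_irrefl)

lemma rmax_mult_left_mono:
  fixes a b c :: rmax
  assumes "a \<le> b"
  shows "c * a \<le> c * b"
  using assms rmax_mult_strict_left_mono[of a b c] by (cases "c = 0") (auto simp: le_less)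

lemma rmax_sum_le_iff:
  fixes f :: "'a \<Rightarrow> rmax"
  assumes "finite A"
  shows "sum f A \<le> b \<longleftrightarrow> (\<forall>i\<in>A. f i \<le> b)"
  using assms by (induction A rule: finite_induct) (auto simp: rmax_add_eq_max)

text \<open>The conjunct \<open>0 < b\<close> accounts for the empty sum, which is minus
  infinity.\<close>

lemma rmax_sum_less_iff:
  fixes f :: "'a \<Rightarrow> rmax"
  assumes "finite A"
  shows "sum f A < b \<longleftrightarrow> 0 < b \<and> (\<forall>i\<in>A. f i < b)"
  using assms by (induction A rule: finite_induct) (auto simp: rmax_add_eq_max)

lemma rmax_member_le_sum:
  fixes f :: "'a \<Rightarrow> rmax"
  assumes "finite A" "i \<in> A"
  shows "f i \<le> sum f A"
  using assms rmax_sum_le_iff[of A f "sum f A"] by auto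

section \<open>Completeness and topology, read off through the exponential\<close>

lemma exp_rmax_nonneg: "0 \<le> exp_rmax a"
  by transfer auto

lemma exp_rmax_surj:
  assumes "0 \<le> r"
  obtains a where "exp_rmax a = r"
proof -
  have "\<exists>a. exp_rmax a = r"
    using assms
  proof (transfer, goal_cases)
    case (1 r)
    then show ?case
      by (intro bexI[of _ "if r = 0 then -\<infinity> else ereal (ln r)"]) auto
  qed
  then show ?thesis using that by blast
qed

lemma exp_rmax_le_iff: "exp_rmax a \<le> exp_rmax b \<longleftrightarrow> a \<le> b"
proof (transfer, goal_cases)
  case (1 a b)
  then show ?case by (cases a; cases b) (auto simp: not_le)
qed

lemma exp_rmax_less_iff: "exp_rmax a < exp_rmax b \<longleftrightarrow> a < b"
  using exp_rmax_le_iff[of b a] by auto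

text \<open>\<open>exp_rmax\<close> is an order isomorphism onto the nonnegative reals, so infima
  are pulled back from there. The strict form is chosen because it yields a witness below any b
  above the infimum, which need not be attained.\<close>

lemma rmax_glb_exists:
  fixes S :: "rmax set"
  assumes "S \<noteq> {}"
  shows "\<exists>m. \<forall>b. m < b \<longleftrightarrow> (\<exists>x\<in>S. x < b)"
proof -
  have bdd: "bdd_below (exp_rmax ` S)"
    by (auto intro: bdd_belowI[of _ 0] exp_rmax_nonneg)
  have "0 \<le> Inf (exp_rmax ` S)"
    using assms by (intro cInf_greatest) (auto intro: exp_rmax_nonneg)
  then obtain m where m: "exp_rmax m = Inf (exp_rmax ` S)"
    by (rule exp_rmax_surj)
  have "m < b \<longleftrightarrow> (\<exists>x\<in>S. x < b)" for b
    using cInf_less_iff[OF _ bdd, of "exp_rmax b"] assms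
    by (simp add: m[symmetric] exp_rmax_less_iff)
  then show ?thesis by blast
qed

text \<open>Minus infinity is not isolated in the exponential metric, so a may be \<open>0\<close>
  as well.\<close>

lemma rmax_greater_near:
  fixes a :: rmax
  assumes "0 < e"
  shows "\<exists>b. a < b \<and> dist b a < e"
proof -
  obtain b where b: "exp_rmax b = exp_rmax a + e / 2"
    using exp_rmax_surj[of "exp_rmax a + e / 2"] exp_rmax_nonneg[of a] assms by auto
  then have "a < b"
    using assms by (simp flip: exp_rmax_less_iff)
  then show ?thesis
    using b assms by (auto simp: dist_rmax_def)
qed

lemma rmax_vec_strict_approx:
  fixes t :: "rmax^'n"
  assumes "open U" "t \<in> U"
  obtains t' where "t' \<in> U" "\<And>i. t $ i < t' $ i"
proof -
  \<comment> \<open>Approaching each coordinate from above at rate 1/(m+1) gives a sequence of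
    vectors that converges to t and hence enters U.\<close>
  have "\<exists>b. t $ i < b \<and> dist b (t $ i) < inverse (real (Suc m))" for i m
    by (rule rmax_greater_near) simp
  then obtain x where x: "\<And>i m. t $ i < x i m"
      "\<And>i m. dist (x i m) (t $ i) < inverse (real (Suc m))"
    by metis
  have "(\<lambda>m. x i m) \<longlonglongrightarrow> t $ i" for i
    unfolding tendsto_dist_iff[of _ "t $ i"]
    by (rule tendsto_sandwich[OF _ _ tendsto_const LIMSEQ_inverse_real_of_nat])
      (use x(2) in \<open>auto intro!: always_eventually less_imp_le\<close>)
  then have "(\<lambda>m. \<chi> i. x i m) \<longlonglongrightarrow> t"
    by (intro vec_tendstoI) simp
  then have "\<forall>\<^sub>F m in sequentially. (\<chi> i. x i m) \<in> U"
    using assms by (rule topological_tendstoD)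
  then obtain m where "(\<chi> i. x i m) \<in> U"
    by (auto simp: eventually_sequentially)
  then show ?thesis
    using x(1) by (intro that[of "\<chi> i. x i m"]) auto
qed

section \<open>Closure properties of polar cones and the separation argument\<close>

lemma polar_cone_le: "polar_cone W \<Longrightarrow> f \<le> g \<Longrightarrow> (f, g) \<in> W"
  by (auto simp: polar_cone_def)

lemma polar_cone_trans: "polar_cone W \<Longrightarrow> (f, g) \<in> W \<Longrightarrow> (g, h) \<in> W \<Longrightarrow> (f, h) \<in> W"
  by (auto simp: polar_cone_def pre_congruence_def)

lemma polar_cone_combine:
  assumes "polar_cone W" "(f, g) \<in> W" "(f', g') \<in> W"
  shows "(a *s f + b *s f', a *s g + b *s g') \<in> W"
proof -
  have "scale_pair a (f, g) + scale_pair b (f', g') \<in> W"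
    using assms unfolding polar_cone_def pre_congruence_def subsemimodule_def by blast
  then show ?thesis by (simp add: scale_pair_def)
qed

lemma polar_cone_scale:
  assumes "polar_cone W" "(f, g) \<in> W"
  shows "(c *s f, c *s g) \<in> W"
  using polar_cone_combine[OF assms assms(2), of c 0] by simp

lemma polar_cone_add:
  assumes "polar_cone W" "(f, g) \<in> W" "(f', g') \<in> W"
  shows "(f + f', g + g') \<in> W"
  using polar_cone_combine[OF assms, of 1 1] by (simp add: vec_eq_iff)

lemma polar_cone_sum:
  assumes "polar_cone W" "finite A" "\<And>i. i \<in> A \<Longrightarrow> (f i, g i) \<in> W"
  shows "(\<Sum>i\<in>A. f i, \<Sum>i\<in>A. g i) \<in> W"
  using assms(2,3)
  by (induction A rule: finite_induct)
    (auto intro: polar_cone_add[OF assms(1)] polar_cone_le[OF assms(1)])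

lemma rmax_vec_axis_expansion: "(\<Sum>i\<in>UNIV. x $ i *s axis i 1) = (x :: rmax^'n)"
  by (simp add: vec_eq_iff axis_def if_distrib[of "(*) _"] cong: if_cong)

lemma rmax_scale_axis_le: "x $ i *s axis i 1 \<le> (x :: rmax^'n)"
  by (auto simp: less_eq_vec_def axis_def)

theorem theorem8:
  fixes W :: "((rmax^'n) \<times> (rmax^'n)) set" and s t :: "rmax^'n"
  assumes "polar_cone W" and "closed W" and "(s, t) \<notin> W"
  shows "\<exists>y :: rmax^'n.
    (\<forall>f g. (f, g) \<in> W \<longrightarrow> (\<Sum>i\<in>UNIV. f $ i * y $ i) \<le> (\<Sum>j\<in>UNIV. g $ j * y $ j)) \<and>
    \<not> (\<Sum>i\<in>UNIV. s $ i * y $ i) \<le> (\<Sum>j\<in>UNIV. t $ j * y $ j)"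
proof -
  note W = assms(1)
  let ?e = "\<lambda>i::'n. axis i 1 :: rmax^'n"
  have "open {x. (s, x) \<notin> W}"
    using continuous_open_preimage[OF _ open_UNIV, of "\<lambda>x. (s, x)" "- W"] assms(2)
    by (simp add: vimage_def continuous_intros open_Compl)
  then obtain t' where t': "(s, t') \<notin> W" and less: "\<And>i. t $ i < t' $ i"
    using rmax_vec_strict_approx[of "{x. (s, x) \<notin> W}" t] assms(3) by blast
  have "\<exists>k. (s $ k *s ?e k, t') \<notin> W"
  proof (rule ccontr)
    assume "\<nexists>k. (s $ k *s ?e k, t') \<notin> W"
    then have "(\<Sum>k\<in>UNIV. s $ k *s ?e k, \<Sum>k\<in>(UNIV::'n set). t') \<in> W"
      by (intro polar_cone_sum[OF W]) auto
    \<comment> \<open>Addition is idempotent: the maximum of copies of t' is t' again.\<close>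
    moreover have "(\<Sum>k\<in>(UNIV::'n set). t') \<le> t'"
      by (simp add: less_eq_vec_def rmax_sum_le_iff del: sum_constant)
    ultimately have "(s, t') \<in> W"
      using polar_cone_trans[OF W] polar_cone_le[OF W] rmax_vec_axis_expansion[of s] by metis
    with t' show False by contradiction
  qed
  then obtain k where k: "(s $ k *s ?e k, t') \<notin> W" by blast
  \<comment> \<open>Otherwise the left vector would be minus infinity everywhere, hence below t' and
    related to it.\<close>
  have "s $ k \<noteq> 0"
    using k polar_cone_le[OF W, of "s $ k *s ?e k" t'] by (auto simp: less_eq_vec_def)
  have "t' $ i \<noteq> 0" for i
    using less[of i] rmax_zero_le[of "t $ i"] by (metis not_le)
  then have "\<forall>i. \<exists>b. t' $ i * b = 1"
    using rmax_inverse_exists by metis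
  then obtain v where v: "\<And>i. t' $ i * v i = 1" by metis
  define u where "u i = s $ k * v i" for i
  have t'u: "t' $ i * u i = s $ k" for i
    using v[of i] by (simp add: u_def mult.left_commute)
  have u0: "u i \<noteq> 0" for i
    using t'u[of i] \<open>s $ k \<noteq> 0\<close> by auto
  \<comment> \<open>By the choice of u, \<open>D g \<le> 1\<close> amounts to
    \<open>s $ k *s g \<le> t'\<close>.\<close>
  define D where "D x = (\<Sum>i\<in>UNIV. x $ i * u i)" for x :: "rmax^'n"
  have D_add: "D (\<Sum>j\<in>UNIV. c j *s h j) = (\<Sum>j\<in>UNIV. c j * D (h j))" for c and h :: "'n \<Rightarrow> _"
    unfolding D_def
    by (simp add: sum_distrib_left sum_distrib_right mult.assoc) (rule sum.swap)
  have D_e: "D (?e i) = u i" for i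
    by (simp add: D_def axis_def if_distrib[of "\<lambda>x. x * _"] cong: if_cong)
  \<comment> \<open>By reflexivity \<open>?e i\<close> itself is a candidate, so each infimum is
    over a nonempty set.\<close>
  have "\<forall>i. \<exists>m. \<forall>b. m < b \<longleftrightarrow> (\<exists>x\<in>D ` {g. (?e i, g) \<in> W}. x < b)"
    using polar_cone_le[OF W order_refl] by (intro allI rmax_glb_exists) auto
  then have "\<exists>Y. \<forall>i b. Y i < b \<longleftrightarrow> (\<exists>g. (?e i, g) \<in> W \<and> D g < b)"
    by (auto dest!: choice)
  then obtain Y where Y: "\<And>i b. Y i < b \<longleftrightarrow> (\<exists>g. (?e i, g) \<in> W \<and> D g < b)"
    by blast
  have Y_le: "Y i \<le> D g" if "(?e i, g) \<in> W" for i g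
    using Y[of i "Y i"] Y[of i "D g"] that by (meson less_irrefl not_le)
  \<comment> \<open>If \<open>g\<close> had a value below \<open>Y i\<close>, pick for each j a
    near-optimal \<open>h j\<close> above \<open>?e j\<close> in the preorder. Replacing each
    \<open>?e j\<close> in the expansion of \<open>g\<close> by \<open>h j\<close> gives, by
    transitivity, a candidate for \<open>Y i\<close> whose \<open>D\<close> value is below the
    infimum.\<close>
  have Y_axis: "Y i \<le> (\<Sum>j\<in>UNIV. g $ j * Y j)" if g: "(?e i, g) \<in> W" for i g
  proof (rule ccontr)
    assume "\<not> ?thesis"
    then have pos: "0 < Y i" and lt: "\<And>j. g $ j * Y j < Y i"
      by (auto simp: not_le rmax_sum_less_iff)
    have "\<exists>h. (?e j, h) \<in> W \<and> g $ j * D h < Y i" for j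
    proof (cases "g $ j = 0")
      case True
      then show ?thesis
        using pos polar_cone_le[OF W order_refl] by auto
    next
      case False
      then obtain c where c: "g $ j * c = 1" by (rule rmax_inverse_exists)
      \<comment> \<open>Dividing by \<open>g $ j\<close> puts \<open>c * Y i\<close> strictly above
        the infimum \<open>Y j\<close>, so some candidate lies below it.\<close>
      have "g $ j * Y j < g $ j * (c * Y i)"
        using lt[of j] c by (simp flip: mult.assoc)
      then have "Y j < c * Y i"
        using False by (simp add: rmax_mult_less_cancel_left)
      then obtain h where h: "(?e j, h) \<in> W" "D h < c * Y i"
        using Y by blast
      have "g $ j * D h < g $ j * (c * Y i)"
        using h(2) False by (rule rmax_mult_strict_left_mono)
      then show ?thesis
        using h(1) c by (auto simp flip: mult.assoc)
    qed
    then obtain h where h: "\<And>j. (?e j, h j) \<in> W" "\<And>j. g $ j * D (h j) < Y i"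
      by metis
    have "(\<Sum>j\<in>UNIV. g $ j *s ?e j, \<Sum>j\<in>UNIV. g $ j *s h j) \<in> W"
      by (intro polar_cone_sum[OF W] polar_cone_scale[OF W] h(1)) simp
    then have "(?e i, \<Sum>j\<in>UNIV. g $ j *s h j) \<in> W"
      using polar_cone_trans[OF W g] by (simp add: rmax_vec_axis_expansion)
    then have "Y i \<le> D (\<Sum>j\<in>UNIV. g $ j *s h j)"
      by (rule Y_le)
    moreover have "D (\<Sum>j\<in>UNIV. g $ j *s h j) < Y i"
      using h(2) pos by (simp add: D_add rmax_sum_less_iff)
    ultimately show False by simp
  qed
  have mono: "(\<Sum>i\<in>UNIV. f $ i * Y i) \<le> (\<Sum>j\<in>UNIV. g $ j * Y j)" if fg: "(f, g) \<in> W" for f g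
  proof -
    \<comment> \<open>For finite \<open>f $ i\<close>, the relation
      \<open>f $ i *s ?e i \<le> f\<close> \<preceq> \<open>g\<close> divided by
      \<open>f $ i\<close> reduces the claim to \<open>Y_axis\<close>.\<close>
    have "f $ i * Y i \<le> (\<Sum>j\<in>UNIV. g $ j * Y j)" for i
    proof (cases "f $ i = 0")
      case False
      then obtain c where c: "f $ i * c = 1" by (rule rmax_inverse_exists)
      have "(f $ i *s ?e i, g) \<in> W"
        using polar_cone_trans[OF W polar_cone_le[OF W rmax_scale_axis_le] fg] .
      then have "(c *s (f $ i *s ?e i), c *s g) \<in> W"
        by (rule polar_cone_scale[OF W])
      then have "(?e i, c *s g) \<in> W"
        using c by (simp add: vector_smult_assoc mult.commute)
      then have "Y i \<le> (\<Sum>j\<in>UNIV. (c *s g) $ j * Y j)"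
        by (rule Y_axis)
      also have "\<dots> = c * (\<Sum>j\<in>UNIV. g $ j * Y j)"
        by (simp add: sum_distrib_left mult.assoc)
      finally have "f $ i * Y i \<le> f $ i * (c * (\<Sum>j\<in>UNIV. g $ j * Y j))"
        by (rule rmax_mult_left_mono)
      then show ?thesis
        using c by (simp flip: mult.assoc)
    qed simp
    then show ?thesis by (simp add: rmax_sum_le_iff)
  qed
  have "1 \<le> Y k"
  proof (rule ccontr)
    assume "\<not> 1 \<le> Y k"
    then obtain g where g: "(?e k, g) \<in> W" "D g < 1"
      using Y[of k 1] by (auto simp: not_le)
    have "s $ k * g $ i \<le> t' $ i" for i
    proof -
      have "g $ i * u i \<le> 1"
        using g(2) by (simp add: D_def rmax_sum_less_iff less_imp_le)
      then have "t' $ i * (g $ i * u i) \<le> t' $ i * 1"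
        by (rule rmax_mult_left_mono)
      then show ?thesis
        by (simp add: t'u[of i, symmetric] mult_ac)
    qed
    then have "s $ k *s g \<le> t'"
      by (simp add: less_eq_vec_def)
    then have "(s $ k *s ?e k, t') \<in> W"
      using polar_cone_trans[OF W polar_cone_scale[OF W g(1)] polar_cone_le[OF W]] by blast
    with k show False by contradiction
  qed
  have "t $ i * Y i < s $ k" for i
  proof -
    have "Y i \<le> u i"
      using Y_le[OF polar_cone_le[OF W order_refl]] D_e by metis
    then have "t $ i * Y i \<le> t $ i * u i"
      by (rule rmax_mult_left_mono)
    \<comment> \<open>The strict gap between t and t' survives the multiplication because
      \<open>u i\<close> is finite.\<close>
    also have "\<dots> < t' $ i * u i"
      using rmax_mult_strict_left_mono[OF less u0] by (simp add: mult.commute)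
    finally show ?thesis by (simp add: t'u)
  qed
  then have "(\<Sum>j\<in>UNIV. t $ j * Y j) < s $ k"
    using \<open>s $ k \<noteq> 0\<close> by (simp add: rmax_sum_less_iff rmax_pos_iff)
  also have "s $ k \<le> s $ k * Y k"
    using rmax_mult_left_mono[OF \<open>1 \<le> Y k\<close>, of "s $ k"] by simp
  also have "\<dots> \<le> (\<Sum>i\<in>UNIV. s $ i * Y i)"
    by (rule rmax_member_le_sum) auto
  finally show ?thesis
    using mono by (intro exI[of _ "\<chi> i. Y i"]) (auto simp: not_le)
qed

end
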